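(* Suppose that $g$ has the form $$g(t)=\begin{cases} g_-(t)<0, & t\le t_0,\\ g_+>0, & t>t_0,\end{cases}$$ with some positive constants $t_0$, $g_+$ and a negative function $g_-(t)$. Let $q$, $t_1$, $t_2$, $\bar t_2$, $\bar q$ be as defined in the context. Then $$0\le t_2-\bar t_2\le \frac{1}{n(q_s)},$$ $$\sup_{t\in[0,\bar t_2]}|q(t)-\bar q(t)|\le q_s,$$ $$|\dot q(\bar t_2)-\dot{\bar q}(\bar t_2)|=\dot q(\bar t_2)\le \frac{g_+}{n(q_s)}.$$ Moreover, both $q(t)$ and $\bar q(t)$ are non-decreasing for $t\ge \bar t_2$ and $$|q(t)-\bar q(t)|\le\begin{cases}\bar q(t), & \text{if } \bar t_2\le t<t_2,\\ \bar q(t)-\bar q(t-\tau), & \text{if } t\ge t_2,\end{cases}$$ with $\tau=t_2-\bar t_2$.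
   Context: Let $n:(0,\infty)\to(0,\infty)$ be a given differentiable, decreasing, positive function with $n=N'$, where $N(q)\to-\infty$ as $q\to 0$. Let $g\in L^1_{loc}(\mathbb R^+)$. Let $q_0>0$, $v_0\in\mathbb R$, and let $q$ be the unique positive global solution (in $W^{1,\infty}_{loc}(\mathbb R^+)$) of $$\ddot q=-n(q)\dot q+g,\qquad q(0)=q_0,\ \dot q(0)=v_0 .$$ (Existence and uniqueness of this solution is known; the same is true for initial data prescribed at any other initial time.) Fix a threshold $q_s>0$ with $q_0>q_s$ and suppose that $q$ reaches $q_s$; let $t_1$ be the first time at which $q(t_1)=q_s$. Let $t_2\ge t_1$ be the time when $q$ goes above the threshold again, i.e. $t_2=\inf\{t\ge t_1: q(t)>q_s\}$ (with $t_2=\infty$ if there is no such time). For $t\ge t_1$ set $$\bar v(t)=\dot q(t_1)+\int_{t_1}^t g(s)\,ds,$$ and let $\bar t_2$ be the first time $t\ge t_1$ such that $\bar v(t)=0$ (with $\bar t_2=\infty$ if there is none). The approximated trajectory $\bar q$ is defined by: $\bar q(t)=q(t)$ for $0\le t<t_1$; $\bar q(t)=q_s$ for $t_1\le t<\bar t_2$; and for $t\ge\bar t_2$, $\bar q$ is the solution of $\ddot{\bar q}=-n(\bar q)\dot{\bar q}+g$ with $\bar q(\bar t_2)=q_s$, $\dot{\bar q}(\bar t_2)=0$. *)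

theory Defs
  imports "HOL-Analysis.Analysis"
begin

text \<open>
  Membership in \<open>L\<^sup>1_loc\<close> of the closed half-line \<open>[a, \<infinity>)\<close>: integrability up to the end point \<open>a\<close>
  is included, as initial data are prescribed there.
\<close>

definition loc_integrable_from :: "real \<Rightarrow> (real \<Rightarrow> real) \<Rightarrow> bool" where
  "loc_integrable_from a h \<longleftrightarrow> (\<forall>b\<ge>a. h absolutely_integrable_on {a..b})"

text \<open>
  \<open>u\<close> is the absolutely continuous representative of a \<open>W\<^sup>1\<^sup>,\<^sup>1_loc\<close> function on \<open>[a, \<infinity>)\<close> whose
  weak derivative is the locally integrable function \<open>h\<close>.
\<close>

definition has_weak_derivative_from :: "real \<Rightarrow> (real \<Rightarrow> real) \<Rightarrow> (real \<Rightarrow> real) \<Rightarrow> bool" where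
  "has_weak_derivative_from a u h \<longleftrightarrow>
     loc_integrable_from a h \<and> (\<forall>t\<ge>a. u t = u a + integral {a..t} h)"

text \<open>
  \<open>q\<close> is a positive global solution on \<open>[a, \<infinity>)\<close> of \<open>q'' = - n(q) q' + g\<close> with \<open>q(a) = qa\<close> and
  \<open>q'(a) = va\<close>; the argument \<open>q'\<close> is the derivative of \<open>q\<close>, which \<open>q\<close> determines on \<open>[a, \<infinity>)\<close>.
  As \<open>g\<close> is only locally integrable, the equation is understood in the weak sense. A weak solution
  in \<open>W\<^sup>1\<^sup>,\<^sup>\<infinity>_loc\<close> has \<open>q''\<close> in \<open>L\<^sup>1_loc\<close>, so \<open>q\<close> is continuously differentiable with \<open>q'\<close> locally
  absolutely continuous, and the pointwise values of \<open>q'\<close> make sense (at \<open>a\<close>, \<open>q'\<close> is the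
  right derivative).
\<close>

definition positive_solution_from ::
  "(real \<Rightarrow> real) \<Rightarrow> (real \<Rightarrow> real) \<Rightarrow> real \<Rightarrow> real \<Rightarrow> real \<Rightarrow> (real \<Rightarrow> real) \<Rightarrow> (real \<Rightarrow> real) \<Rightarrow> bool"
where
  "positive_solution_from n g a qa va q q' \<longleftrightarrow>
     (\<forall>t\<ge>a. q t > 0) \<and>
     (\<forall>t\<ge>a. (q has_real_derivative q' t) (at t within {a..})) \<and>
     has_weak_derivative_from a q' (\<lambda>t. - n (q t) * q' t + g t) \<and>
     q a = qa \<and> q' a = va"

text \<open>
  The times below are extended reals: the infimum of the empty set is \<open>\<infinity>\<close>.
\<close>

definition exit_time :: "(real \<Rightarrow> real) \<Rightarrow> real \<Rightarrow> real \<Rightarrow> ereal" where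
  "exit_time q qs t1 = (INF t\<in>{t. t \<ge> t1 \<and> q t > qs}. ereal t)"

definition approx_velocity :: "(real \<Rightarrow> real) \<Rightarrow> real \<Rightarrow> real \<Rightarrow> real \<Rightarrow> real" where
  "approx_velocity g t1 v1 t = v1 + integral {t1..t} g"

text \<open>
  For locally integrable \<open>g\<close> the velocity is continuous on \<open>[t1, \<infinity>)\<close>, so its zero set there is
  closed and the infimum, if finite, is the first zero.
\<close>

definition approx_exit_time :: "(real \<Rightarrow> real) \<Rightarrow> real \<Rightarrow> real \<Rightarrow> ereal" where
  "approx_exit_time g t1 v1 = (INF t\<in>{t. t \<ge> t1 \<and> approx_velocity g t1 v1 t = 0}. ereal t)"

text \<open>
  \<open>qbar'\<close> is the velocity of \<open>qbar\<close> on \<open>[T, \<infinity>)\<close>, where \<open>T\<close> is the approximate exit time; its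
  values before \<open>T\<close> are irrelevant.
\<close>

definition approx_trajectory ::
  "(real \<Rightarrow> real) \<Rightarrow> (real \<Rightarrow> real) \<Rightarrow> real \<Rightarrow> (real \<Rightarrow> real) \<Rightarrow> (real \<Rightarrow> real) \<Rightarrow> real \<Rightarrow>
    (real \<Rightarrow> real) \<Rightarrow> (real \<Rightarrow> real) \<Rightarrow> bool"
where
  "approx_trajectory n g qs q q' t1 qbar qbar' \<longleftrightarrow>
     (\<forall>t. 0 \<le> t \<and> t < t1 \<longrightarrow> qbar t = q t) \<and>
     (\<forall>t. t1 \<le> t \<and> ereal t < approx_exit_time g t1 (q' t1) \<longrightarrow> qbar t = qs) \<and>
     (\<forall>T. approx_exit_time g t1 (q' t1) = ereal T \<longrightarrow>
        positive_solution_from n g T qs 0 qbar qbar')"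

end

theory Submission
  imports Defs
begin

text \<open>
  Since \<open>n = N'\<close>, the equation \<open>q'' = - n(q) q' + g\<close> says that \<open>q' + N(q)\<close> has the weak derivative
  \<open>g\<close>. Solutions therefore obey the first-order equation
  \<open>q'(t) = v(t) + N(q\<^sub>s) - N(q(t))\<close> for \<open>t \<ge> t\<^sub>1\<close>, where \<open>v\<close> is the approximate velocity of the
  statement (lemma \<open>first_order_form\<close>). Its right-hand side is decreasing in \<open>q\<close>, because
  \<open>N\<close> is increasing, so solutions can be compared with each other and with constants. All
  comparisons come from one barrier principle (lemma \<open>nonpos_if_no_growth_where_positive\<close>), applied
  to \<open>q\<close> through the first-order equation and to \<open>q'\<close> through the original one.

  Write \<open>T\<close> for the approximate exit time. The velocity \<open>v\<close> starts with
  \<open>v(t\<^sub>1) = q'(t\<^sub>1) \<le> 0\<close>, the inequality being strict if the threshold is hit while \<open>g < 0\<close> (lemma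
  \<open>velocity_neg_at_first_hit\<close>). It decreases up to \<open>t\<^sub>0\<close> and has slope \<open>g\<^sub>+\<close> afterwards.
  Hence \<open>T\<close> is finite, \<open>T \<ge> t\<^sub>0\<close>, and \<open>v(t) = g\<^sub>+ (t - T)\<close> from \<open>T\<close> on.
  While \<open>v \<le> 0\<close>, the trajectory stays below \<open>q\<^sub>s\<close>; this gives \<open>t\<^sub>2 \<ge> T\<close> and the bound by \<open>q\<^sub>s\<close> up to
  \<open>T\<close>. As long as \<open>q \<le> q\<^sub>s\<close>, the friction coefficient is at least \<open>n(q\<^sub>s)\<close>, so \<open>q'\<close> cannot exceed the limit
  velocity \<open>g\<^sub>+ / n(q\<^sub>s)\<close>; but then also \<open>N(q\<^sub>s) - N(q) \<ge> 0\<close>, so that \<open>q' \<ge> g\<^sub>+ (t - T)\<close> from \<open>T\<close> on.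
  The two bounds together give \<open>t - T \<le> 1 / n(q\<^sub>s)\<close> for all such \<open>t\<close>, hence \<open>t\<^sub>2 - T \<le> 1 / n(q\<^sub>s)\<close>.

  After \<open>T\<close> the two trajectories solve the same first-order equation, with \<open>q(T) \<le> q\<^sub>s\<close>, so
  \<open>q\<close> stays below the approximation. The approximation delayed by \<open>\<tau> = t\<^sub>2 - T\<close> starts from \<open>q\<^sub>s\<close> at
  time \<open>t\<^sub>2\<close>, where \<open>q\<close> also equals \<open>q\<^sub>s\<close>, and is driven by the smaller velocity
  \<open>g\<^sub>+ (t - \<tau> - T)\<close>; so it stays below \<open>q\<close>. This encloses \<open>q\<close> between the approximation and its
  delay.
\<close>

section \<open>A barrier principle\<close>

text \<open>
  Between the last time at which \<open>d \<le> 0\<close> and a later time with \<open>d > 0\<close>, the function would have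
  grown through positive values. The hypothesis compares two values of \<open>d\<close> instead of
  bounding a derivative, so that it can be verified for merely absolutely continuous \<open>d\<close> as well.
\<close>

lemma nonpos_if_no_growth_where_positive:
  fixes d :: "real \<Rightarrow> real"
  assumes cont: "continuous_on {a..b} d" and init: "d a \<le> 0"
    and no_growth: "\<And>s c. a \<le> s \<Longrightarrow> s < c \<Longrightarrow> c \<le> b \<Longrightarrow> (\<And>x. s < x \<Longrightarrow> x \<le> c \<Longrightarrow> 0 < d x) \<Longrightarrow> d c \<le> d s"
    and t: "a \<le> t" "t \<le> b"
  shows "d t \<le> 0"
proof (rule ccontr)
  assume "\<not> d t \<le> 0"
  then have pos: "d t > 0" by simp
  define S where "S = {x \<in> {a..t}. d x \<le> 0}"
  have contt: "continuous_on {a..t} d"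
    using cont by (rule continuous_on_subset) (use t in auto)
  have "closed S"
    unfolding S_def by (intro continuous_on_closed_Collect_le contt continuous_on_const) auto
  moreover have "bounded S"
    by (rule bounded_subset[OF bounded_closed_interval[of a t]]) (auto simp: S_def)
  ultimately have "compact S"
    by (simp add: compact_eq_bounded_closed)
  moreover have "a \<in> S"
    using init t by (simp add: S_def)
  ultimately obtain s where s: "s \<in> S" "\<forall>x\<in>S. x \<le> s"
    using compact_attains_sup[of S] by auto
  have st: "a \<le> s" "s < t"
    using s(1) pos by (auto simp: S_def less_le)
  have "0 < d x" if "s < x" "x \<le> t" for x
  proof (rule ccontr)
    assume "\<not> 0 < d x"
    then have "x \<in> S" using that st by (simp add: S_def)
    with s(2) that show False by auto
  qed
  then have "d t \<le> d s"
    using no_growth[of s t] st t by auto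
  with s(1) pos show False by (auto simp: S_def)
qed

lemma nonpos_if_derivative_nonpos_where_positive:
  fixes d d' :: "real \<Rightarrow> real"
  assumes cont: "continuous_on {a..b} d" and init: "d a \<le> 0"
    and deriv: "\<And>x. a < x \<Longrightarrow> x < b \<Longrightarrow> (d has_real_derivative d' x) (at x)"
    and nonpos: "\<And>x. a < x \<Longrightarrow> x < b \<Longrightarrow> 0 < d x \<Longrightarrow> d' x \<le> 0"
    and t: "a \<le> t" "t \<le> b"
  shows "d t \<le> 0"
proof (rule nonpos_if_no_growth_where_positive[OF cont init _ t])
  fix s c assume sc: "a \<le> s" "s < c" "c \<le> b" and pos: "\<And>x. s < x \<Longrightarrow> x \<le> c \<Longrightarrow> 0 < d x"
  show "d c \<le> d s"
  proof (rule DERIV_nonpos_imp_decreasing_open[where f = d])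
    show "continuous_on {s..c} d"
      using cont by (rule continuous_on_subset) (use sc in auto)
    show "\<exists>y. (d has_real_derivative y) (at x) \<and> y \<le> 0" if "s < x" "x < c" for x
      using deriv[of x] nonpos[of x] pos[of x] that sc by auto
  qed (use sc in auto)
qed

lemma le_if_derivative_le_where_greater:
  fixes x y x' y' :: "real \<Rightarrow> real"
  assumes cont: "continuous_on {a..b} x" "continuous_on {a..b} y" and init: "x a \<le> y a"
    and deriv: "\<And>t. a < t \<Longrightarrow> t < b \<Longrightarrow> (x has_real_derivative x' t) (at t)"
      "\<And>t. a < t \<Longrightarrow> t < b \<Longrightarrow> (y has_real_derivative y' t) (at t)"
    and le: "\<And>t. a < t \<Longrightarrow> t < b \<Longrightarrow> y t < x t \<Longrightarrow> x' t \<le> y' t"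
    and "a \<le> b"
  shows "x b \<le> y b"
proof -
  have "x b - y b \<le> 0"
  proof (rule nonpos_if_derivative_nonpos_where_positive[of a b "\<lambda>t. x t - y t" "\<lambda>t. x' t - y' t"])
    show "((\<lambda>t. x t - y t) has_real_derivative x' t - y' t) (at t)" if "a < t" "t < b" for t
      using deriv that by (intro derivative_intros) auto
    show "x' t - y' t \<le> 0" if "a < t" "t < b" "0 < x t - y t" for t
      using le[of t] that by simp
  qed (use assms in \<open>auto intro!: continuous_intros\<close>)
  then show ?thesis by simp
qed

lemma nonpos_if_weak_derivative_nonpos_where_positive:
  fixes d h :: "real \<Rightarrow> real"
  assumes cont: "continuous_on {a..b} d" and init: "d a \<le> 0"
    and int: "\<And>s c. a \<le> s \<Longrightarrow> s \<le> c \<Longrightarrow> c \<le> b \<Longrightarrow> (h has_integral (d c - d s)) {s..c}"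
    and nonpos: "\<And>x. a < x \<Longrightarrow> x \<le> b \<Longrightarrow> 0 < d x \<Longrightarrow> h x \<le> 0"
    and t: "a \<le> t" "t \<le> b"
  shows "d t \<le> 0"
proof (rule nonpos_if_no_growth_where_positive[OF cont init _ t])
  fix s c assume sc: "a \<le> s" "s < c" "c \<le> b" and pos: "\<And>x. s < x \<Longrightarrow> x \<le> c \<Longrightarrow> 0 < d x"
  have "(h has_integral (d c - d s)) {s..c}"
    using int sc by auto
  \<comment> \<open>\<open>d\<close> need not be positive at \<open>s\<close>, and then nothing is known about the sign of \<open>h s\<close>.\<close>
  then have "((\<lambda>x. if x = s then 0 else h x) has_integral (d c - d s)) {s..c}"
    by (rule has_integral_spike_finite[of "{s}", rotated 2]) auto
  from has_integral_le[OF this has_integral_0] have "d c - d s \<le> 0"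
    using nonpos pos sc by auto
  then show "d c \<le> d s" by simp
qed


section \<open>Weak solutions\<close>

lemma weak_derivative_has_integral:
  assumes "has_weak_derivative_from a u h" "a \<le> s" "s \<le> t"
  shows "(h has_integral (u t - u s)) {s..t}"
proof -
  have int: "h integrable_on {a..t}"
    using assms by (simp add: has_weak_derivative_from_def loc_integrable_from_def
        absolutely_integrable_on_def)
  have "integral {a..s} h + integral {s..t} h = integral {a..t} h"
    by (rule Henstock_Kurzweil_Integration.integral_combine[OF assms(2,3) int])
  moreover have "u t = u a + integral {a..t} h" "u s = u a + integral {a..s} h"
    using assms unfolding has_weak_derivative_from_def by (blast intro: order_trans)+
  ultimately have "integral {s..t} h = u t - u s" by linarith
  moreover have "h integrable_on {s..t}"
    using int by (rule integrable_on_subinterval) (use assms in auto)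
  ultimately show ?thesis by (metis integrable_integral)
qed

lemma weak_derivative_continuous:
  assumes "has_weak_derivative_from a u h"
  shows "continuous_on {a..b} u"
proof -
  have "h integrable_on {a..b}"
    using weak_derivative_has_integral[OF assms, of a b]
    by (cases "a \<le> b") (auto simp: integrable_on_def)
  then have "continuous_on {a..b} (\<lambda>t. u a + integral {a..t} h)"
    by (intro continuous_intros indefinite_integral_continuous_1)
  moreover have "u t = u a + integral {a..t} h" if "t \<in> {a..b}" for t
    using assms that unfolding has_weak_derivative_from_def by (meson atLeastAtMost_iff)
  ultimately show ?thesis by (metis (no_types, lifting) continuous_on_cong)
qed

lemma positive_solution_pos: "positive_solution_from n g a qa va q q' \<Longrightarrow> a \<le> t \<Longrightarrow> 0 < q t"
  by (simp add: positive_solution_from_def)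

lemma positive_solution_weak:
  "positive_solution_from n g a qa va q q' \<Longrightarrow>
    has_weak_derivative_from a q' (\<lambda>t. - n (q t) * q' t + g t)"
  by (simp add: positive_solution_from_def)

lemma positive_solution_deriv_within:
  "positive_solution_from n g a qa va q q' \<Longrightarrow> a \<le> t \<Longrightarrow>
    (q has_real_derivative q' t) (at t within {a..})"
  by (simp add: positive_solution_from_def)

lemma positive_solution_deriv:
  assumes "positive_solution_from n g a qa va q q'" "a < t"
  shows "(q has_real_derivative q' t) (at t)"
  using positive_solution_deriv_within[OF assms(1), of t] assms(2)
    at_within_interior[of t "{a..}"] by simp

lemma positive_solution_continuous:
  assumes "positive_solution_from n g a qa va q q'" "S \<subseteq> {a..}"
  shows "continuous_on S q"
proof -
  have "continuous_on {a..} q"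
    by (rule DERIV_continuous_on[of _ _ q']) (simp add: positive_solution_deriv_within[OF assms(1)])
  then show ?thesis by (rule continuous_on_subset) (rule assms(2))
qed

lemma mono_on_if_velocity_nonneg:
  assumes sol: "positive_solution_from n g a qa va q q'" and "a \<le> s"
    and nonneg: "\<And>t. s \<le> t \<Longrightarrow> 0 \<le> q' t"
  shows "mono_on {s..} q"
proof (rule mono_onI)
  fix x y assume xy: "x \<in> {s..}" "y \<in> {s..}" "x \<le> y"
  show "q x \<le> q y"
  proof (rule DERIV_nonneg_imp_increasing_open[where f = q])
    show "continuous_on {x..y} q"
      using positive_solution_continuous[OF sol] xy assms(2) by auto
    show "\<exists>z. (q has_real_derivative z) (at t) \<and> 0 \<le> z" if "x < t" "t < y" for t
      using positive_solution_deriv[OF sol, of t] nonneg[of t] that xy assms(2) by auto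
  qed (use xy in auto)
qed

text \<open>
  Above the level \<open>C\<close>, friction exceeds \<open>n (q t) * C\<close> and so outweighs the forcing. The forcing is
  bounded only after \<open>s\<close>, because a piecewise given forcing may still have its earlier value at
  \<open>s\<close> itself.
\<close>

lemma velocity_le:
  assumes sol: "positive_solution_from n g a qa va q q'"
    and n_pos: "\<And>x. 0 < x \<Longrightarrow> 0 < n x"
    and s: "a \<le> s" and init: "q' s \<le> C"
    and forcing: "\<And>t. s < t \<Longrightarrow> t \<le> b \<Longrightarrow> g t \<le> n (q t) * C"
    and t: "s \<le> t" "t \<le> b"
  shows "q' t \<le> C"
proof -
  have "q' t - C \<le> 0"
  proof (rule nonpos_if_weak_derivative_nonpos_where_positive[of s b "\<lambda>t. q' t - C" "\<lambda>t. - n (q t) * q' t + g t"])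
    show "continuous_on {s..b} (\<lambda>t. q' t - C)"
      using weak_derivative_continuous[OF positive_solution_weak[OF sol], of b] s
      by (intro continuous_intros) (auto intro: continuous_on_subset)
    show "((\<lambda>t. - n (q t) * q' t + g t) has_integral q' y - C - (q' x - C)) {x..y}"
      if "s \<le> x" "x \<le> y" for x y
      using weak_derivative_has_integral[OF positive_solution_weak[OF sol], of x y] that s by simp
    show "- n (q x) * q' x + g x \<le> 0" if x: "s < x" "x \<le> b" "0 < q' x - C" for x
    proof -
      have "0 < n (q x)"
        using n_pos positive_solution_pos[OF sol] s x by simp
      then have "n (q x) * C \<le> n (q x) * q' x"
        using x by simp
      with forcing[of x] x show ?thesis by simp
    qed
  qed (use init t in auto)
  then show ?thesis by simp
qed

text \<open>
  The mirror image of the previous lemma; with \<open>C = 0\<close> it says that a nonnegative forcing never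
  turns a trajectory back.
\<close>

lemma velocity_ge:
  assumes sol: "positive_solution_from n g a qa va q q'"
    and n_pos: "\<And>x. 0 < x \<Longrightarrow> 0 < n x"
    and s: "a \<le> s" and init: "C \<le> q' s"
    and forcing: "\<And>t. s < t \<Longrightarrow> t \<le> b \<Longrightarrow> n (q t) * C \<le> g t"
    and t: "s \<le> t" "t \<le> b"
  shows "C \<le> q' t"
proof -
  have "C - q' t \<le> 0"
  proof (rule nonpos_if_weak_derivative_nonpos_where_positive[of s b "\<lambda>t. C - q' t" "\<lambda>t. - (- n (q t) * q' t + g t)"])
    show "continuous_on {s..b} (\<lambda>t. C - q' t)"
      using weak_derivative_continuous[OF positive_solution_weak[OF sol], of b] s
      by (intro continuous_intros) (auto intro: continuous_on_subset)
    show "((\<lambda>t. - (- n (q t) * q' t + g t)) has_integral C - q' y - (C - q' x)) {x..y}"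
      if "s \<le> x" "x \<le> y" for x y
      using has_integral_neg[OF weak_derivative_has_integral[OF positive_solution_weak[OF sol], of x y]] that s by simp
    show "- (- n (q x) * q' x + g x) \<le> 0" if x: "s < x" "x \<le> b" "0 < C - q' x" for x
    proof -
      have "0 < n (q x)"
        using n_pos positive_solution_pos[OF sol] s x by simp
      then have "n (q x) * q' x \<le> n (q x) * C"
        using x by simp
      with forcing[of x] x show ?thesis by simp
    qed
  qed (use init t in auto)
  then show ?thesis by simp
qed

text \<open>
  The friction \<open>n (q t) * q' t\<close> is the derivative of \<open>N (q t)\<close>, so integrating the equation once
  removes it from under the integral.
\<close>

lemma first_order_form:
  assumes sol: "positive_solution_from n g a qa va q q'"
    and N_deriv: "\<And>x. 0 < x \<Longrightarrow> (N has_real_derivative n x) (at x)"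
    and st: "a \<le> s" "s \<le> t"
  shows "(g has_integral (q' t + N (q t) - (q' s + N (q s)))) {s..t}"
proof -
  have "((\<lambda>x. n (q x) * q' x) has_integral (N (q t) - N (q s))) {s..t}"
  proof (rule fundamental_theorem_of_calculus[OF st(2)])
    fix x assume x: "x \<in> {s..t}"
    have "((\<lambda>x. N (q x)) has_real_derivative n (q x) * q' x) (at x within {a..})"
      using positive_solution_deriv_within[OF sol, of x] positive_solution_pos[OF sol, of x] x st
      by (intro DERIV_chain2[OF N_deriv]) auto
    then have "((\<lambda>x. N (q x)) has_real_derivative n (q x) * q' x) (at x within {s..t})"
      by (rule DERIV_subset) (use st in auto)
    then show "((\<lambda>x. N (q x)) has_vector_derivative n (q x) * q' x) (at x within {s..t})"
      by (simp add: has_real_derivative_iff_has_vector_derivative)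
  qed
  from has_integral_add[OF weak_derivative_has_integral[OF positive_solution_weak[OF sol] st] this]
  show ?thesis by (simp add: algebra_simps)
qed

lemma first_order_form_const_forcing:
  assumes sol: "positive_solution_from n g a qa va q q'"
    and N_deriv: "\<And>x. 0 < x \<Longrightarrow> (N has_real_derivative n x) (at x)"
    and st: "a \<le> s" "s \<le> t"
    and const: "\<And>x. s < x \<Longrightarrow> x \<le> t \<Longrightarrow> g x = G"
  shows "q' t + N (q t) = q' s + N (q s) + G * (t - s)"
proof -
  have "(g has_integral G * (t - s)) {s..t}"
    by (rule has_integral_spike_finite[of "{s}" _ _ "\<lambda>_. G"])
      (use const st has_integral_const_real[of G s t] in \<open>auto simp: mult.commute\<close>)
  from has_integral_unique[OF first_order_form[OF sol N_deriv st] this]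
  show ?thesis by simp
qed


section \<open>The potential\<close>

lemma antiderivative_strict_mono:
  fixes N n :: "real \<Rightarrow> real"
  assumes N_deriv: "\<And>x. 0 < x \<Longrightarrow> (N has_real_derivative n x) (at x)"
    and n_pos: "\<And>x. 0 < x \<Longrightarrow> 0 < n x"
    and "0 < x" "x < y"
  shows "N x < N y"
proof (rule DERIV_pos_imp_increasing[OF \<open>x < y\<close>])
  fix z assume "x \<le> z"
  then have "0 < z" using \<open>0 < x\<close> by simp
  then show "\<exists>v. (N has_real_derivative v) (at z) \<and> 0 < v"
    using N_deriv n_pos by blast
qed

lemma antiderivative_below_tangent:
  fixes N n :: "real \<Rightarrow> real"
  assumes N_deriv: "\<And>x. 0 < x \<Longrightarrow> (N has_real_derivative n x) (at x)"
    and n_decreasing: "antimono_on {0<..} n"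
    and "0 < x" "x \<le> y"
  shows "N y - N x \<le> n x * (y - x)"
proof (cases "x = y")
  case False
  then have "x < y" using assms by simp
  then obtain z where z: "x < z" "z < y" "N y - N x = (y - x) * n z"
    using MVT2[of x y N n] N_deriv \<open>0 < x\<close> by (meson less_le_trans)
  have "n z \<le> n x"
    using monotone_onD[OF n_decreasing, of x z] z \<open>0 < x\<close> by auto
  then show ?thesis
    using z \<open>x < y\<close> by (simp add: mult.commute)
qed simp


section \<open>Times defined by a threshold\<close>

lemma first_hit_from_above:
  fixes q :: "real \<Rightarrow> real"
  assumes cont: "continuous_on {a..T} q" and init: "k < q a"
    and avoid: "\<And>t. a \<le> t \<Longrightarrow> t < T \<Longrightarrow> q t \<noteq> k"
    and t: "a \<le> t" "t < T"
  shows "k < q t"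
proof (rule ccontr)
  assume "\<not> k < q t"
  moreover have "continuous_on {a..t} q"
    using cont by (rule continuous_on_subset) (use t in auto)
  ultimately obtain s where "a \<le> s" "s \<le> t" "q s = k"
    using IVT2'[of q t k a] init t by auto
  with avoid t show False by force
qed

text \<open>
  The threshold value is attained at the exit time: \<open>q t2\<close> is at least \<open>k\<close> as a
  limit of values above \<open>k\<close>, and if it were larger, an intermediate value above \<open>k\<close> would
  already be taken before \<open>t2\<close>.
\<close>

lemma exit_time_properties:
  fixes q :: "real \<Rightarrow> real"
  assumes cont: "continuous_on {t1..} q" and start: "q t1 = k"
    and exits: "t1 \<le> e" "k < q e"
  obtains t2 where "exit_time q k t1 = ereal t2" "t1 \<le> t2" "q t2 = k"
    "\<And>t. t1 \<le> t \<Longrightarrow> t \<le> t2 \<Longrightarrow> q t \<le> k"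
proof -
  define E where "E = {t. t1 \<le> t \<and> k < q t}"
  have ne: "E \<noteq> {}" and bdd: "bdd_below E"
    using exits by (auto simp: E_def bdd_below_def)
  define t2 where "t2 = Inf E"
  have "t2 \<in> {t \<in> {t1..}. k \<le> q t}"
    unfolding t2_def using ne bdd
    by (intro closed_subset_contains_Inf continuous_on_closed_Collect_le cont continuous_on_const)
      (auto simp: E_def)
  then have t2: "t1 \<le> t2" "k \<le> q t2" by auto
  have before: "q t \<le> k" if "t1 \<le> t" "t < t2" for t
    using cInf_lower[OF _ bdd, of t] that by (force simp: E_def t2_def)
  have "q t2 \<le> k"
  proof (rule ccontr)
    assume "\<not> q t2 \<le> k"
    moreover have "continuous_on {t1..t2} q"
      using cont by (rule continuous_on_subset) auto
    ultimately obtain s where "t1 \<le> s" "s \<le> t2" "q s = (k + q t2) / 2"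
      using IVT'[of q t1 "(k + q t2) / 2" t2] start t2 by auto
    with before[of s] \<open>\<not> q t2 \<le> k\<close> show False
      by (cases "s = t2") auto
  qed
  moreover have "exit_time q k t1 = ereal t2"
    using ereal_Inf'[OF bdd ne] by (simp add: exit_time_def t2_def E_def)
  ultimately show thesis
    using that[of t2] t2 before by (metis antisym order.order_iff_strict)
qed

lemma approx_exit_time_eq:
  assumes T: "t1 \<le> T" "approx_velocity g t1 v1 T = 0"
    and first: "\<And>t. t1 \<le> t \<Longrightarrow> t < T \<Longrightarrow> approx_velocity g t1 v1 t < 0"
  shows "approx_exit_time g t1 v1 = ereal T"
  unfolding approx_exit_time_def
proof (rule antisym)
  show "(INF t\<in>{t. t1 \<le> t \<and> approx_velocity g t1 v1 t = 0}. ereal t) \<le> ereal T"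
    by (rule INF_lower) (use T in auto)
  show "ereal T \<le> (INF t\<in>{t. t1 \<le> t \<and> approx_velocity g t1 v1 t = 0}. ereal t)"
    by (rule INF_greatest) (use first in \<open>force simp: not_le[symmetric]\<close>)
qed

text \<open>
  The initial velocity must be strictly negative for \<open>t1 \<le> t0\<close>: if it vanished with \<open>t1 < t0\<close>, the
  approximate exit time would be \<open>t1\<close> itself, before the forcing turns.
\<close>

lemma approx_exit_time_exists:
  assumes g_int: "\<And>b. g integrable_on {t1..b}"
    and g_early: "\<And>t. t1 \<le> t \<Longrightarrow> t \<le> t0 \<Longrightarrow> g t \<le> 0"
    and g_late: "\<And>t. t1 \<le> t \<Longrightarrow> t0 < t \<Longrightarrow> g t = G" and "0 < G"
    and v1: "v1 \<le> 0" "t1 \<le> t0 \<Longrightarrow> v1 < 0"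
  obtains T where "approx_exit_time g t1 v1 = ereal T" "t0 \<le> T" "t1 \<le> T"
    "approx_velocity g t1 v1 T = 0"
    "\<And>t. t1 \<le> t \<Longrightarrow> t < T \<Longrightarrow> approx_velocity g t1 v1 t < 0"
proof -
  define v where "v = approx_velocity g t1 v1"
  define m where "m = max t0 t1"
  \<comment> \<open>From \<open>m\<close> on, the approximate velocity is affine with slope \<open>G\<close>; this is its zero.\<close>
  define T where "T = m - v m / G"
  have early: "v t < 0" if "t1 \<le> t" "t \<le> t0" for t
  proof -
    have "integral {t1..t} g \<le> integral {t1..t} (\<lambda>_. 0)"
      by (rule integral_le) (use g_int g_early that in auto)
    then show ?thesis using v1 that by (simp add: v_def approx_velocity_def)
  qed
  have "v m \<le> 0"
  proof (cases "t1 \<le> t0")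
    case True
    then show ?thesis using early[of t0] by (simp add: m_def max_def)
  next
    case False
    then show ?thesis using v1 by (simp add: m_def v_def approx_velocity_def)
  qed
  then have "m \<le> T" using \<open>0 < G\<close> by (simp add: T_def divide_nonpos_pos)
  have late: "v t = G * (t - T)" if "m \<le> t" for t
  proof -
    have "(g has_integral G * (t - m)) {m..t}"
      by (rule has_integral_spike_finite[of "{m}" _ _ "\<lambda>_. G"])
        (use g_late that has_integral_const_real[of G m t] in \<open>auto simp: mult.commute m_def\<close>)
    then have "integral {m..t} g = G * (t - m)" by (rule integral_unique)
    moreover have "integral {t1..m} g + integral {m..t} g = integral {t1..t} g"
      by (rule Henstock_Kurzweil_Integration.integral_combine[OF _ that g_int]) (simp add: m_def)
    ultimately have "v t = v m + G * (t - m)"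
      by (simp add: v_def approx_velocity_def)
    moreover have "G * T = G * m - v m" using \<open>0 < G\<close> by (simp add: T_def field_simps)
    ultimately show ?thesis by (simp add: algebra_simps)
  qed
  have "v t < 0" if "t1 \<le> t" "t < T" for t
  proof (cases "t \<le> t0")
    case True
    with early that show ?thesis by simp
  next
    case False
    with late[of t] that \<open>0 < G\<close> show ?thesis by (simp add: m_def mult_pos_neg)
  qed
  moreover have "v T = 0" using late[of T] \<open>m \<le> T\<close> by simp
  ultimately show thesis
    using that[of T] approx_exit_time_eq[of t1 T g v1] \<open>m \<le> T\<close> by (simp add: v_def m_def)
qed


section \<open>Crossing the threshold\<close>

lemma velocity_nonpos_at_first_hit:
  assumes deriv: "(q has_real_derivative v) (at T)" and "a < T" "q T = k"
    and above: "\<And>t. a \<le> t \<Longrightarrow> t < T \<Longrightarrow> k < q t"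
  shows "v \<le> 0"
proof (rule ccontr)
  assume "\<not> v \<le> 0"
  then obtain \<delta> where \<delta>: "0 < \<delta>" "\<And>h. 0 < h \<Longrightarrow> h < \<delta> \<Longrightarrow> q (T - h) < q T"
    using DERIV_pos_inc_left[OF deriv] by auto
  define h where "h = min (\<delta> / 2) (T - a)"
  have h: "0 < h" "h < \<delta>" "h \<le> T - a"
    using \<delta>(1) \<open>a < T\<close> by (auto simp: h_def)
  then have "q (T - h) < k"
    using \<delta>(2)[of h] \<open>q T = k\<close> by simp
  with above[of "T - h"] h show False by simp
qed

text \<open>
  With \<open>g \<le> 0\<close> the threshold is hit transversally. If \<open>q' T\<close> were nonnegative, the first-order form
  and concavity of \<open>N\<close> would give \<open>q' \<ge> - n k * (q - k)\<close> before \<open>T\<close>, a linear inequality under which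
  the positive quantity \<open>q - k\<close> can decay exponentially but cannot reach zero.
\<close>

lemma velocity_neg_at_first_hit:
  assumes sol: "positive_solution_from n g a qa va q q'"
    and N_deriv: "\<And>x. 0 < x \<Longrightarrow> (N has_real_derivative n x) (at x)"
    and n_decreasing: "antimono_on {0<..} n"
    and T: "a < T" "q T = k"
    and above: "\<And>t. a \<le> t \<Longrightarrow> t < T \<Longrightarrow> k < q t"
    and g_nonpos: "\<And>t. a \<le> t \<Longrightarrow> t \<le> T \<Longrightarrow> g t \<le> 0"
  shows "q' T < 0"
proof (rule ccontr)
  assume "\<not> q' T < 0"
  then have end_nonneg: "0 \<le> q' T" by simp
  have "0 < k" using positive_solution_pos[OF sol, of T] T by simp
  \<comment> \<open>The integrating factor of the linear inequality makes \<open>y\<close> nondecreasing.\<close>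
  define y where "y = (\<lambda>t. exp (n k * t) * (q t - k))"
  have "y a \<le> y T"
  proof (rule DERIV_nonneg_imp_increasing_open[where f = y])
    show "continuous_on {a..T} y"
      unfolding y_def using positive_solution_continuous[OF sol, of "{a..T}"]
      by (intro continuous_intros) auto
    fix t assume t: "a < t" "t < T"
    have "(y has_real_derivative exp (n k * t) * (n k * (q t - k) + q' t)) (at t)"
      unfolding y_def using positive_solution_deriv[OF sol t(1)]
      by (auto intro!: derivative_eq_intros simp: algebra_simps)
    moreover have "0 \<le> n k * (q t - k) + q' t"
    proof -
      have "q' T + N (q T) - (q' t + N (q t)) \<le> 0"
        by (rule has_integral_le[OF first_order_form[OF sol N_deriv] has_integral_0])
          (use t g_nonpos in auto)
      moreover have "N (q t) - N k \<le> n k * (q t - k)"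
        using antiderivative_below_tangent[OF N_deriv n_decreasing \<open>0 < k\<close>] above[of t] t by simp
      ultimately show ?thesis using end_nonneg T by simp
    qed
    ultimately show "\<exists>z. (y has_real_derivative z) (at t) \<and> 0 \<le> z" by auto
  qed (use T in simp)
  moreover have "0 < y a" using above[of a] T by (simp add: y_def)
  moreover have "y T = 0" using T by (simp add: y_def)
  ultimately show False by simp
qed

text \<open>
  Above the threshold, \<open>N\<close> exceeds \<open>N k\<close>, so by the first-order form \<open>q'\<close> is even less than the
  approximate velocity.
\<close>

lemma below_threshold_while_approx_velocity_nonpos:
  assumes sol: "positive_solution_from n g a qa va q q'"
    and N_deriv: "\<And>x. 0 < x \<Longrightarrow> (N has_real_derivative n x) (at x)"
    and n_pos: "\<And>x. 0 < x \<Longrightarrow> 0 < n x"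
    and t1: "a \<le> t1" "q t1 = k"
    and vel: "\<And>t. t1 \<le> t \<Longrightarrow> t < T \<Longrightarrow> approx_velocity g t1 (q' t1) t \<le> 0"
    and t: "t1 \<le> t" "t \<le> T"
  shows "q t \<le> k"
proof -
  have "0 < k" using positive_solution_pos[OF sol t1(1)] t1 by simp
  have "q t - k \<le> 0"
  proof (rule nonpos_if_derivative_nonpos_where_positive[of t1 T "\<lambda>t. q t - k" q'])
    show "continuous_on {t1..T} (\<lambda>t. q t - k)"
      using positive_solution_continuous[OF sol, of "{t1..T}"] t1 by (auto intro!: continuous_intros)
    fix x assume x: "t1 < x" "x < T"
    show "((\<lambda>t. q t - k) has_real_derivative q' x) (at x)"
      using positive_solution_deriv[OF sol, of x] x t1 by (auto intro!: derivative_eq_intros)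
    assume "0 < q x - k"
    then have "N k < N (q x)"
      using antiderivative_strict_mono[OF N_deriv n_pos \<open>0 < k\<close>] by simp
    moreover have "integral {t1..x} g = q' x + N (q x) - (q' t1 + N k)"
      using integral_unique[OF first_order_form[OF sol N_deriv, of t1 x]] x t1 by simp
    ultimately show "q' x \<le> 0"
      using vel[of x] x by (simp add: approx_velocity_def)
  qed (use t1 t in auto)
  then show ?thesis by simp
qed


section \<open>Error of the approximation by a resting trajectory\<close>

theorem proposition4:
  fixes n N g gm q q' qbar qbar' :: "real \<Rightarrow> real"
    and gp t0 q0 v0 qs t1 :: real
  assumes n_pos: "\<And>x. x > 0 \<Longrightarrow> n x > 0"
    and n_diff: "n differentiable_on {0<..}"
    and n_decreasing: "antimono_on {0<..} n"
    and N_deriv: "\<And>x. x > 0 \<Longrightarrow> (N has_real_derivative n x) (at x)"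
    and N_lim: "filterlim N at_bot (at_right 0)"
    and g_loc: "loc_integrable_from 0 g"
    and t0_pos: "t0 > 0"
    and gp_pos: "gp > 0"
    and gm_neg: "\<And>t. 0 \<le> t \<Longrightarrow> t \<le> t0 \<Longrightarrow> gm t < 0"
    and g_form: "\<And>t. 0 \<le> t \<Longrightarrow> g t = (if t \<le> t0 then gm t else gp)"
    and q0_pos: "q0 > 0"
    and q_sol: "positive_solution_from n g 0 q0 v0 q q'"
    and qs_pos: "qs > 0"
    and q0_gt: "q0 > qs"
    and t1_nonneg: "t1 \<ge> 0"
    and t1_hit: "q t1 = qs"
    and t1_first: "\<And>t. 0 \<le> t \<Longrightarrow> t < t1 \<Longrightarrow> q t \<noteq> qs"
    and qbar: "approx_trajectory n g qs q q' t1 qbar qbar'"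
  shows "\<exists>t2 tbar2. exit_time q qs t1 = ereal t2 \<and>
           approx_exit_time g t1 (q' t1) = ereal tbar2 \<and>
           0 \<le> t2 - tbar2 \<and> t2 - tbar2 \<le> 1 / n qs \<and>
           (SUP t\<in>{0..tbar2}. ereal \<bar>q t - qbar t\<bar>) \<le> ereal qs \<and>
           \<bar>q' tbar2 - qbar' tbar2\<bar> = q' tbar2 \<and> q' tbar2 \<le> gp / n qs \<and>
           mono_on {tbar2..} q \<and> mono_on {tbar2..} qbar \<and>
           (\<forall>t. tbar2 \<le> t \<and> t < t2 \<longrightarrow> \<bar>q t - qbar t\<bar> \<le> qbar t) \<and>
           (\<forall>t\<ge>t2. \<bar>q t - qbar t\<bar> \<le> qbar t - qbar (t - (t2 - tbar2)))"
proof -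
  have n_mono: "n qs \<le> n x" if "0 < x" "x \<le> qs" for x
    using monotone_onD[OF n_decreasing, of x qs] that by auto
  have N_le: "N x \<le> N y" if "0 < x" "x \<le> y" for x y
    using antiderivative_strict_mono[OF N_deriv n_pos, of x y] that by (cases "x = y") auto
  have nqs: "0 < n qs" using n_pos qs_pos by simp
  have q_init: "q 0 = q0" using q_sol by (simp add: positive_solution_from_def)
  have t1_pos: "0 < t1" using t1_hit t1_nonneg q_init q0_gt by (cases "t1 = 0") auto
  have q_above: "qs < q t" if "0 \<le> t" "t < t1" for t
    by (rule first_hit_from_above[OF positive_solution_continuous[OF q_sol] _ t1_first that])
      (auto simp: q_init q0_gt)

  \<comment> \<open>The approximate exit time \<open>T\<close>.\<close>
  have v1: "q' t1 \<le> 0"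
    by (rule velocity_nonpos_at_first_hit[OF positive_solution_deriv[OF q_sol t1_pos] t1_pos t1_hit q_above])
  have v1_neg: "q' t1 < 0" if "t1 \<le> t0"
    by (rule velocity_neg_at_first_hit[OF q_sol N_deriv n_decreasing t1_pos t1_hit q_above])
      (use g_form gm_neg that in \<open>auto simp: less_imp_le\<close>)
  have g_int: "g integrable_on {t1..b}" for b
    using first_order_form[OF q_sol N_deriv, of t1 b] t1_nonneg
    by (cases "t1 \<le> b") (auto simp: integrable_on_def)
  obtain T where T: "approx_exit_time g t1 (q' t1) = ereal T" "t0 \<le> T" "t1 \<le> T"
      "approx_velocity g t1 (q' t1) T = 0"
      "\<And>t. t1 \<le> t \<Longrightarrow> t < T \<Longrightarrow> approx_velocity g t1 (q' t1) t < 0"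
    by (rule approx_exit_time_exists[OF g_int _ _ gp_pos v1 v1_neg, of t0])
      (use g_form gm_neg t1_nonneg in \<open>auto simp: less_imp_le\<close>)
  have T_pos: "0 < T" using T(3) t1_pos by simp
  have g_late: "g t = gp" if "t0 < t" for t
    using g_form[of t] that t0_pos by simp

  have q_below: "q t \<le> qs" if "t1 \<le> t" "t \<le> T" for t
    by (rule below_threshold_while_approx_velocity_nonpos
        [OF q_sol N_deriv n_pos t1_nonneg t1_hit less_imp_le[OF T(5)] that])
  have qbar_sol: "positive_solution_from n g T qs 0 qbar qbar'"
    using qbar T(1) by (simp add: approx_trajectory_def)
  then have qbar_T: "qbar T = qs" "qbar' T = 0"
    by (simp_all add: positive_solution_from_def)

  have q_at_T: "q' T + N (q T) = N qs"
    using integral_unique[OF first_order_form[OF q_sol N_deriv t1_nonneg T(3)]] T(4) t1_hit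
    by (simp add: approx_velocity_def)
  have q_vel: "q' t = N qs - N (q t) + gp * (t - T)" if "T \<le> t" for t
    using first_order_form_const_forcing[OF q_sol N_deriv _ that, of gp] q_at_T g_late T(2) T_pos
    by simp
  have qbar_vel: "qbar' t = N qs - N (qbar t) + gp * (t - T)" if "T \<le> t" for t
    using first_order_form_const_forcing[OF qbar_sol N_deriv _ that, of gp] qbar_T g_late T(2)
    by simp

  \<comment> \<open>From \<open>m\<close> on, the forcing is constant and \<open>q\<close> has already reached the threshold. As the
    velocity at \<open>m\<close> is not positive, the limit velocity is a barrier while \<open>q \<le> qs\<close>.\<close>
  define m where "m = max t0 t1"
  have m: "0 \<le> m" "m \<le> T" "t1 \<le> m" "t0 \<le> m"
    using t1_nonneg T(2,3) by (auto simp: m_def)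
  have vm: "q' m \<le> 0"
  proof (cases "t1 \<le> t0")
    case True
    have "q' t0 \<le> 0"
      by (rule velocity_le[OF q_sol n_pos t1_nonneg v1 _ True order_refl])
        (use g_form gm_neg t1_nonneg in \<open>auto simp: less_imp_le\<close>)
    with True show ?thesis by (simp add: m_def max_def)
  qed (use v1 in \<open>simp add: m_def\<close>)
  have vel_bound: "q' S \<le> gp / n qs" if S: "T \<le> S" "\<And>t. t1 \<le> t \<Longrightarrow> t \<le> S \<Longrightarrow> q t \<le> qs" for S
  proof (rule velocity_le[OF q_sol n_pos m(1), of _ S])
    show "q' m \<le> gp / n qs"
      using vm gp_pos nqs by (meson divide_nonneg_pos less_imp_le order_trans)
    fix t assume t: "m < t" "t \<le> S"
    have "n qs \<le> n (q t)"
      using n_mono[of "q t"] positive_solution_pos[OF q_sol, of t] S(2)[of t] t m by simp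
    then have "n qs * (gp / n qs) \<le> n (q t) * (gp / n qs)"
      using gp_pos nqs by (intro mult_right_mono) auto
    then show "g t \<le> n (q t) * (gp / n qs)"
      using g_late[of t] t m nqs by simp
  qed (use S m in auto)
  have delay: "S - T \<le> 1 / n qs" if S: "T \<le> S" "\<And>t. t1 \<le> t \<Longrightarrow> t \<le> S \<Longrightarrow> q t \<le> qs" for S
  proof -
    have "N (q S) \<le> N qs"
      using N_le positive_solution_pos[OF q_sol, of S] S T(3) T_pos by simp
    then have "gp * (S - T) \<le> gp / n qs"
      using q_vel[OF S(1)] vel_bound[OF S] by simp
    then have "gp * (S - T) \<le> gp * (1 / n qs)" by simp
    then show ?thesis using gp_pos mult_le_cancel_left_pos by blast
  qed

  \<comment> \<open>\<open>delay\<close> bounds every time up to which \<open>q\<close> stays below the threshold, so it first shows that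
    \<open>q\<close> leaves at all, and then bounds the exit time.\<close>
  have "\<exists>e\<ge>t1. qs < q e"
  proof (rule ccontr)
    assume "\<not> (\<exists>e\<ge>t1. qs < q e)"
    then have "T + 1 / n qs + 1 - T \<le> 1 / n qs"
      using nqs by (intro delay) (auto simp: not_less)
    then show False by simp
  qed
  then obtain e where e: "t1 \<le> e" "qs < q e" by blast
  obtain t2 where t2: "exit_time q qs t1 = ereal t2" "t1 \<le> t2" "q t2 = qs"
      and q_below_t2: "\<And>t. t1 \<le> t \<Longrightarrow> t \<le> t2 \<Longrightarrow> q t \<le> qs"
    by (rule exit_time_properties[OF positive_solution_continuous[OF q_sol] t1_hit e, of thesis])
      (use t1_nonneg in auto)
  have "T \<le> t2"
  proof -
    have "ereal T \<le> exit_time q qs t1"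
      unfolding exit_time_def
      by (rule INF_greatest) (use q_below in \<open>force simp: not_le[symmetric]\<close>)
    then show ?thesis using t2(1) by simp
  qed

  have vT_nonneg: "0 \<le> q' T"
    using N_le[OF _ q_below[OF T(3) order_refl]] q_at_T positive_solution_pos[OF q_sol, of T] T_pos
    by simp
  have q_mono: "mono_on {T..} q"
  proof (rule mono_on_if_velocity_nonneg[OF q_sol])
    show "0 \<le> q' t" if "T \<le> t" for t
      by (rule velocity_ge[OF q_sol n_pos _ vT_nonneg _ that order_refl])
        (use g_late T(2) T_pos gp_pos in auto)
  qed (use T_pos in simp)
  have qbar_mono: "mono_on {T..} qbar"
  proof (rule mono_on_if_velocity_nonneg[OF qbar_sol order_refl])
    show "0 \<le> qbar' t" if "T \<le> t" for t
      by (rule velocity_ge[OF qbar_sol n_pos order_refl _ _ that order_refl])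
        (use g_late T(2) qbar_T gp_pos in auto)
  qed

  have q_le_qbar: "q t \<le> qbar t" if t: "T \<le> t" for t
  proof (rule le_if_derivative_le_where_greater[OF _ _ _ _ _ _ t])
    show "continuous_on {T..t} q" "continuous_on {T..t} qbar"
      using positive_solution_continuous[OF q_sol] positive_solution_continuous[OF qbar_sol] T_pos
      by auto
    show "q T \<le> qbar T"
      using q_below[OF T(3) order_refl] qbar_T by simp
    fix x assume x: "T < x"
    show "(q has_real_derivative q' x) (at x)" "(qbar has_real_derivative qbar' x) (at x)"
      using positive_solution_deriv[OF q_sol] positive_solution_deriv[OF qbar_sol] x T_pos by auto
    assume "qbar x < q x"
    then have "N (qbar x) \<le> N (q x)"
      using N_le positive_solution_pos[OF qbar_sol] x by simp
    then show "q' x \<le> qbar' x"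
      using q_vel[of x] qbar_vel[of x] x by simp
  qed

  \<comment> \<open>The delayed approximation meets \<open>q\<close> at \<open>t2\<close>; in the first-order equation, its driving velocity
    is smaller by \<open>gp * \<tau>\<close>.\<close>
  define \<tau> where "\<tau> = t2 - T"
  have \<tau>: "0 \<le> \<tau>" using \<open>T \<le> t2\<close> by (simp add: \<tau>_def)
  have shifted_le_q: "qbar (t - \<tau>) \<le> q t" if t: "t2 \<le> t" for t
  proof (rule le_if_derivative_le_where_greater[OF _ _ _ _ _ _ t])
    show "continuous_on {t2..t} (\<lambda>t. qbar (t - \<tau>))"
      by (rule continuous_on_compose2[OF positive_solution_continuous[OF qbar_sol, of "{T..}"]])
        (auto intro!: continuous_intros simp: \<tau>_def)
    show "continuous_on {t2..t} q"
      using positive_solution_continuous[OF q_sol] t2(2) t1_pos by auto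
    show "qbar (t2 - \<tau>) \<le> q t2"
      using qbar_T t2 by (simp add: \<tau>_def)
    fix x assume x: "t2 < x"
    then have shift: "T < x - \<tau>" by (simp add: \<tau>_def)
    show "((\<lambda>t. qbar (t - \<tau>)) has_real_derivative qbar' (x - \<tau>)) (at x)"
      using DERIV_shift[of qbar "qbar' (x - \<tau>)" x "- \<tau>"] positive_solution_deriv[OF qbar_sol shift]
      by simp
    show "(q has_real_derivative q' x) (at x)"
      using positive_solution_deriv[OF q_sol] x t2(2) t1_pos by auto
    assume "q x < qbar (x - \<tau>)"
    then have "N (q x) \<le> N (qbar (x - \<tau>))"
      using N_le positive_solution_pos[OF q_sol, of x] x t2(2) t1_pos by simp
    moreover have "gp * (x - \<tau> - T) \<le> gp * (x - T)"
      using gp_pos \<tau> by simp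
    ultimately show "qbar' (x - \<tau>) \<le> q' x"
      using q_vel[of x] qbar_vel[of "x - \<tau>"] x shift \<open>T \<le> t2\<close> by simp
  qed

  have sup: "(SUP t\<in>{0..T}. ereal \<bar>q t - qbar t\<bar>) \<le> ereal qs"
  proof (rule SUP_least)
    fix t assume t: "t \<in> {0..T}"
    show "ereal \<bar>q t - qbar t\<bar> \<le> ereal qs"
    proof (cases "t < t1")
      case True
      then have "qbar t = q t"
        using qbar t by (simp add: approx_trajectory_def)
      then show ?thesis using qs_pos by simp
    next
      case False
      then have "qbar t = qs"
        using qbar qbar_T T(1) t by (cases "t = T") (auto simp: approx_trajectory_def)
      moreover have "0 < q t" "q t \<le> qs"
        using positive_solution_pos[OF q_sol] q_below False t by auto
      ultimately show ?thesis by simp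
    qed
  qed
  have before: "\<bar>q t - qbar t\<bar> \<le> qbar t" if "T \<le> t" "t < t2" for t
    using positive_solution_pos[OF q_sol, of t] q_le_qbar[OF that(1)] that T_pos by simp
  have after: "\<bar>q t - qbar t\<bar> \<le> qbar t - qbar (t - (t2 - T))" if "t2 \<le> t" for t
    using q_le_qbar[of t] shifted_le_q[OF that] that \<open>T \<le> t2\<close> by (simp add: \<tau>_def)
  show ?thesis
  proof (intro exI conjI)
    show "exit_time q qs t1 = ereal t2" by (rule t2(1))
    show "approx_exit_time g t1 (q' t1) = ereal T" by (rule T(1))
    show "0 \<le> t2 - T" using \<open>T \<le> t2\<close> by simp
    show "t2 - T \<le> 1 / n qs" by (rule delay[OF \<open>T \<le> t2\<close> q_below_t2])
    show "(SUP t\<in>{0..T}. ereal \<bar>q t - qbar t\<bar>) \<le> ereal qs" by (rule sup)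
    show "\<bar>q' T - qbar' T\<bar> = q' T" using vT_nonneg qbar_T by simp
    show "q' T \<le> gp / n qs" by (rule vel_bound[OF order_refl q_below])
    show "mono_on {T..} q" "mono_on {T..} qbar" by (rule q_mono qbar_mono)+
    show "\<forall>t. T \<le> t \<and> t < t2 \<longrightarrow> \<bar>q t - qbar t\<bar> \<le> qbar t" using before by blast
    show "\<forall>t\<ge>t2. \<bar>q t - qbar t\<bar> \<le> qbar t - qbar (t - (t2 - T))" using after by blast
  qed
qed

end
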